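(* There exist a real $\alpha>0$ and an $n_0\in\mathbb{N}$ such that for every even $n\ge n_0$ there is a directed $3$-regular graph $G$ on $6n$ vertices (that is, the sum of the in-degree and the out-degree of every vertex of $G$ is $3$) such that $\alpha n$ cops do not suffice to catch the robber on $G$, i.e. $\mathrm{ent}(G)>\alpha n$.
   Context: Entanglement game on a finite directed graph $G$ with $k$ cops: First the robber chooses a starting vertex, and all $k$ cops are outside the graph. In every turn, the cops either all stay where they are, or exactly one of them flies (from wherever it is, on or off the graph) to the current position of the robber. Regardless of which of these happened, the robber then has to move to a successor (out-neighbor) of his current position that is not occupied by a cop. If there is no such successor, the cops win. The robber wins if he can run away indefinitely. Both sides have full information. The entanglement number $\mathrm{ent}(G)$ is the minimal integer $k$ such that $k$ cops have a strategy to catch the robber on $G$. "$\alpha n$ cops do not suffice" means that no integer number $k\le\alpha n$ of cops can catch the robber, i.e. $\mathrm{ent}(G)>\alpha n$. Directed graphs have no loops and no parallel arcs. *)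

theory Defs
  imports Complex_Main "Graph_Theory.Digraph"
begin

text \<open>
  The cops are numbered \<open>0, \<dots>, k - 1\<close>. A placement maps every cop to the vertex he occupies,
  or to \<^const>\<open>None\<close> while he is outside the graph.
\<close>

type_synonym 'a placement = "nat \<Rightarrow> 'a option"

text \<open>
  A strategy of the cops sees the nonempty list of vertices visited by the robber so far, the
  current one being last. This is full information, since the placements seen so far are determined
  by that list and the strategy itself. The value \<^const>\<open>None\<close> means that all cops stay where they
  are, and \<open>Some i\<close> that cop \<open>i\<close> flies to the current vertex of the robber.
\<close>

type_synonym 'a cop_strategy = "'a list \<Rightarrow> nat option"

definition cop_strategy :: "nat \<Rightarrow> 'a cop_strategy \<Rightarrow> bool" where
  "cop_strategy k \<sigma> \<longleftrightarrow> (\<forall>h i. \<sigma> h = Some i \<longrightarrow> i < k)"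

fun cop_step :: "nat option \<Rightarrow> 'a \<Rightarrow> 'a placement \<Rightarrow> 'a placement" where
  "cop_step None v c = c"
| "cop_step (Some i) v c = c(i := Some v)"

text \<open>
  \<open>placement \<sigma> r t\<close> is the placement before turn \<open>t\<close>, when the robber is on \<open>r t\<close>;
  in turn \<open>t\<close> the cops move first.
\<close>

primrec placement :: "'a cop_strategy \<Rightarrow> (nat \<Rightarrow> 'a) \<Rightarrow> nat \<Rightarrow> 'a placement" where
  "placement \<sigma> r 0 = (\<lambda>_. None)"
| "placement \<sigma> r (Suc t) = cop_step (\<sigma> (map r [0..<Suc t])) (r t) (placement \<sigma> r t)"

definition robber_escapes :: "('a, 'b) pre_digraph \<Rightarrow> 'a cop_strategy \<Rightarrow> (nat \<Rightarrow> 'a) \<Rightarrow> bool" where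
  "robber_escapes G \<sigma> r \<longleftrightarrow>
     r 0 \<in> verts G \<and>
     (\<forall>t. r t \<rightarrow>\<^bsub>G\<^esub> r (Suc t) \<and> Some (r (Suc t)) \<notin> range (placement \<sigma> r (Suc t)))"

text \<open>
  A play ends only when the robber has no move left, and then the cops have won. So a strategy
  wins for the cops iff no play consistent with it goes on forever.
\<close>

definition cops_can_catch :: "('a, 'b) pre_digraph \<Rightarrow> nat \<Rightarrow> bool" where
  "cops_can_catch G k \<longleftrightarrow> (\<exists>\<sigma>. cop_strategy k \<sigma> \<and> (\<nexists>r. robber_escapes G \<sigma> r))"

definition entanglement :: "('a, 'b) pre_digraph \<Rightarrow> nat" where
  "entanglement G = (LEAST k. cops_can_catch G k)"

text \<open>On a finite digraph the minimum above exists: one cop per vertex suffices.\<close>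

lemma (in fin_digraph) cops_can_catch_card_verts: "cops_can_catch G (card (verts G))"
proof -
  obtain f :: "'a \<Rightarrow> nat" where f: "bij_betw f (verts G) {..<card (verts G)}"
    using ex_bij_betw_finite_nat[OF finite_verts] by (auto simp: atLeast0LessThan)
  define \<sigma> where "\<sigma> h = (if last h \<in> verts G then Some (f (last h)) else None)" for h
  have "cop_strategy (card (verts G)) \<sigma>"
    using f by (auto simp: cop_strategy_def \<sigma>_def bij_betw_def)
  moreover have False if r: "robber_escapes G \<sigma> r" for r
  proof -
    have V: "r t \<in> verts G" for t
    proof -
      have "r t \<rightarrow>\<^bsub>G\<^esub> r (Suc t)"
        using r by (simp add: robber_escapes_def)
      then show ?thesis
        by (auto elim!: reachableE dest: tail_in_verts)
    qed
    have occupied: "placement \<sigma> r t (f (r s)) = Some (r s)" if "s < t" for s t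
      using that
    proof (induction t)
      case (Suc t)
      have "f (r s) = f (r t) \<longleftrightarrow> r s = r t"
        using f V by (auto simp: bij_betw_def inj_on_def)
      with Suc V show ?case
        by (cases "s = t") (auto simp: \<sigma>_def less_Suc_eq)
    qed simp
    have "r s \<noteq> r t" if "s < t" for s t
    proof
      assume eq: "r s = r t"
      obtain t' where t': "t = Suc t'"
        using \<open>s < t\<close> by (cases t) auto
      have "Some (r t) \<notin> range (placement \<sigma> r t)"
        using r unfolding robber_escapes_def t' by blast
      with occupied[OF that] eq show False
        by (metis rangeI)
    qed
    then have "inj r"
      by (metis injI linorder_neqE_nat)
    moreover have "finite (range r)"
      by (rule finite_subset[OF _ finite_verts]) (use V in auto)
    ultimately show False
      using finite_imageD by blast
  qed
  ultimately show ?thesis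
    unfolding cops_can_catch_def by blast
qed

end

theory Submission
  imports Defs "HOL-Library.FuncSet"
begin

text \<open>
  The robber beats \<open>k\<close> cops if every set \<open>X\<close> of at most \<open>k\<close> vertices leaves a strongly connected
  set \<open>\<beta> X\<close> of \<open>G - X\<close> such that any two of these sets meet in at least two vertices: he always
  walks towards the current \<open>\<beta> X\<close>. A cop can only land on his present position, which a simple
  path does not visit again, so the path he is following is never blocked.

  To get such a digraph with \<open>2 * N\<close> vertices, take a loopless directed multigraph with \<open>N\<close> edges on
  \<open>m = 8 * q + 1\<close> labels, \<open>m\<close> being linear in \<open>N\<close>, such that any two disjoint sets of \<open>q\<close> labels are
  joined by an edge in either direction; choosing the heads at random works, by counting. Deleting
  \<open>q\<close> labels leaves more than half of them mutually reachable. Now replace each label by a directed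
  cycle through the edge ends at it, keeping each edge as an arc from its tail end to its head end.
  Tail ends have in-degree 1 and out-degree 2, head ends the other way round, and a cop spoils at
  most one label.
\<close>

section \<open>A robber strategy from havens\<close>

text \<open>Cut the walk at its last visit to \<open>w\<close>. What remains cannot be blocked by a
  cop who lands on \<open>w\<close> while the robber stands there.\<close>

lemma trancl_avoiding_start:
  assumes "(w, z) \<in> R\<^sup>*" "z \<noteq> w"
  shows "(w, z) \<in> {(x, y) \<in> R. y \<noteq> w}\<^sup>+"
proof -
  have "z = w \<or> (w, z) \<in> {(x, y) \<in> R. y \<noteq> w}\<^sup>+"
    using assms(1)
  proof (induction rule: rtrancl_induct)
    case (step y z)
    show ?case
    proof (cases "z = w")
      case False
      with step have "(y, z) \<in> {(x, y) \<in> R. y \<noteq> w}" by simp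
      with step.IH show ?thesis by (auto intro: trancl_into_trancl)
    qed simp
  qed simp
  with assms(2) show ?thesis by simp
qed

text \<open>Only heads have to avoid \<open>X\<close>, because the robber may be sharing his vertex with a cop.\<close>

definition arcs_avoiding :: "('a, 'b) pre_digraph \<Rightarrow> 'a set \<Rightarrow> 'a rel" where
  "arcs_avoiding G X = {(x, y). x \<rightarrow>\<^bsub>G\<^esub> y \<and> y \<notin> X}"

definition occupied :: "'a placement \<Rightarrow> 'a set" where
  "occupied c = {v. Some v \<in> range c}"

lemma occupied_bounded:
  assumes "\<And>i. i \<ge> k \<Longrightarrow> c i = None"
  shows "finite (occupied c)" "card (occupied c) \<le> k"
proof -
  have sub: "occupied c \<subseteq> (the \<circ> c) ` {..<k}"
  proof
    fix v assume "v \<in> occupied c"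
    then obtain i where i: "c i = Some v" by (auto simp: occupied_def)
    with assms[of i] have "i < k" by (cases "i < k") auto
    with i show "v \<in> (the \<circ> c) ` {..<k}" by (force intro: image_eqI[where x = i])
  qed
  show "finite (occupied c)" by (rule finite_subset[OF sub]) simp
  have "card (occupied c) \<le> card ((the \<circ> c) ` {..<k})" by (rule card_mono[OF _ sub]) simp
  also have "\<dots> \<le> k" using card_image_le[of "{..<k}" "the \<circ> c"] by simp
  finally show "card (occupied c) \<le> k" .
qed

lemma occupied_cop_step: "occupied (cop_step s v c) \<subseteq> insert v (occupied c)"
  by (cases s) (auto simp: occupied_def split: if_splits)

text \<open>Invariant: after every cop move, a walk of positive length avoiding the new placement
  leads the robber into its haven. The excluded \<open>w\<close> in \<open>touch\<close> stands for
  the robber's own vertex, which the new target has to differ from.\<close>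

lemma haven_imp_not_catch:
  fixes G :: "('a, 'b) pre_digraph"
  assumes conn: "\<And>X x y. finite X \<Longrightarrow> card X \<le> k \<Longrightarrow> x \<in> \<beta> X \<Longrightarrow> y \<in> \<beta> X \<Longrightarrow>
      (x, y) \<in> (arcs_avoiding G X)\<^sup>*"
    and touch: "\<And>X Y w. finite X \<Longrightarrow> card X \<le> k \<Longrightarrow> finite Y \<Longrightarrow> card Y \<le> k \<Longrightarrow>
      \<exists>z \<in> \<beta> X \<inter> \<beta> Y. z \<noteq> w"
    and verts: "\<beta> {} \<subseteq> verts G"
  shows "\<not> cops_can_catch G k"
proof
  assume "cops_can_catch G k"
  then obtain \<sigma> where \<sigma>: "cop_strategy k \<sigma>" and no: "\<nexists>r. robber_escapes G \<sigma> r"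
    by (auto simp: cops_can_catch_def)
  define small where "small c \<longleftrightarrow> (\<forall>i\<ge>k. c i = None)" for c :: "'a placement"
  define after where "after h c = cop_step (\<sigma> h) (last h) c" for h c
  \<comment> \<open>The closure is not reflexive, because the robber must move even if he already
    stands in the haven.\<close>
  define safe where "safe v X \<longleftrightarrow> (\<exists>z \<in> \<beta> X. (v, z) \<in> (arcs_avoiding G X)\<^sup>+)" for v X
  have small_after: "small (after h c)" if "small c" for h c
  proof (cases "\<sigma> h")
    case (Some i)
    then have "i < k" using \<sigma> by (auto simp: cop_strategy_def)
    with Some that show ?thesis by (auto simp: small_def after_def)
  qed (use that in \<open>simp add: after_def\<close>)
  have safe_after: "safe w (occupied (after h c))"
    if "small c" "last h = w" "(w, z) \<in> (arcs_avoiding G (occupied c))\<^sup>*" "z \<in> \<beta> (occupied c)"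
    for w h c z
  proof -
    let ?X = "occupied c" and ?Y = "occupied (after h c)"
    have fin: "finite ?X" "card ?X \<le> k" "finite ?Y" "card ?Y \<le> k"
      using occupied_bounded[of k c] occupied_bounded[of k "after h c"] that(1) small_after[OF that(1)]
      by (auto simp: small_def)
    then obtain z' where z': "z' \<in> \<beta> ?X" "z' \<in> \<beta> ?Y" "z' \<noteq> w"
      using touch[of ?X ?Y w] by auto
    \<comment> \<open>Inside the old haven the walk is redirected to a vertex shared with the new
      one. It avoids \<open>?X\<close>; once it no longer returns to \<open>w\<close>, it avoids
      \<open>?Y\<close> too, as the cops' move adds at most \<open>w\<close>.\<close>
    have "(w, z') \<in> (arcs_avoiding G ?X)\<^sup>*"
      using that(3) conn[OF fin(1,2) that(4) z'(1)] by simp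
    then have "(w, z') \<in> {(x, y) \<in> arcs_avoiding G ?X. y \<noteq> w}\<^sup>+"
      using z'(3) by (rule trancl_avoiding_start)
    moreover have "{(x, y) \<in> arcs_avoiding G ?X. y \<noteq> w} \<subseteq> arcs_avoiding G ?Y"
      using occupied_cop_step[of "\<sigma> h" w c] that(2) by (auto simp: arcs_avoiding_def after_def)
    ultimately have "(w, z') \<in> (arcs_avoiding G ?Y)\<^sup>+"
      using trancl_mono_subset by blast
    with z'(2) show ?thesis by (auto simp: safe_def)
  qed
  \<comment> \<open>A state consists of the history and the placement before the cops move. The
    clause for \<open>t = 0\<close> fixes the start, since dependent choice yields just some state
    satisfying \<open>P 0\<close>.\<close>
  define P :: "nat \<Rightarrow> 'a list \<times> 'a placement \<Rightarrow> bool" where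
    "P t s \<longleftrightarrow> small (snd s) \<and> safe (last (fst s)) (occupied (after (fst s) (snd s)))
      \<and> (t = 0 \<longrightarrow> (\<exists>v \<in> verts G. s = ([v], \<lambda>_. None)))" for t s
  define Q :: "nat \<Rightarrow> 'a list \<times> 'a placement \<Rightarrow> 'a list \<times> 'a placement \<Rightarrow> bool" where
    "Q t s s' \<longleftrightarrow> (\<exists>w. s' = (fst s @ [w], after (fst s) (snd s)) \<and> last (fst s) \<rightarrow>\<^bsub>G\<^esub> w
      \<and> w \<notin> occupied (after (fst s) (snd s)))" for t s s'
  have "\<exists>s. P 0 s"
  proof -
    obtain v where v: "v \<in> \<beta> {}" using touch[of "{}" "{}" undefined] by auto
    have occ: "occupied (\<lambda>_::nat. None) = ({} :: 'a set)" by (auto simp: occupied_def)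
    have "safe v (occupied (after [v] (\<lambda>_. None)))"
      by (rule safe_after[where z = v]) (use v in \<open>auto simp: small_def occ\<close>)
    then have "P 0 ([v], \<lambda>_. None)" using v verts by (auto simp: P_def small_def)
    then show ?thesis ..
  qed
  moreover have "\<exists>s'. P (Suc t) s' \<and> Q t s s'" if "P t s" for t s
  proof -
    obtain h c where s: "s = (h, c)" by (cases s)
    have sm: "small c" and "safe (last h) (occupied (after h c))"
      using that by (auto simp: P_def s)
    then obtain z where z: "z \<in> \<beta> (occupied (after h c))"
      "(last h, z) \<in> (arcs_avoiding G (occupied (after h c)))\<^sup>+" by (auto simp: safe_def)
    then obtain w where w: "(last h, w) \<in> arcs_avoiding G (occupied (after h c))"
      "(w, z) \<in> (arcs_avoiding G (occupied (after h c)))\<^sup>*" by (meson tranclD)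
    have "safe w (occupied (after (h @ [w]) (after h c)))"
      by (rule safe_after[where z = z]) (use small_after[OF sm] w z in auto)
    then have "P (Suc t) (h @ [w], after h c)" "Q t s (h @ [w], after h c)"
      using small_after[OF sm] w(1) by (auto simp: P_def Q_def s arcs_avoiding_def)
    then show ?thesis by blast
  qed
  ultimately obtain f where f: "\<And>t. P t (f t)" "\<And>t. Q t (f t) (f (Suc t))"
    using dependent_nat_choice[of P Q] by blast
  define r where "r t = last (fst (f t))" for t
  obtain v where v: "v \<in> verts G" "f 0 = ([v], \<lambda>_. None)" using f(1)[of 0] by (auto simp: P_def)
  \<comment> \<open>The chosen states agree with what \<open>placement\<close> computes from
    \<open>r\<close>, so \<open>r\<close> is a genuine play against \<sigma>.\<close>
  have hist: "f t = (map r [0..<Suc t], placement \<sigma> r t)" for t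
  proof (induction t)
    case 0
    then show ?case using v by (simp add: r_def)
  next
    case (Suc t)
    obtain w where w: "f (Suc t) = (fst (f t) @ [w], after (fst (f t)) (snd (f t)))"
      using f(2)[of t] by (auto simp: Q_def)
    then have "w = r (Suc t)" by (simp add: r_def)
    with w Suc show ?case by (simp add: after_def)
  qed
  have "r t \<rightarrow>\<^bsub>G\<^esub> r (Suc t) \<and> Some (r (Suc t)) \<notin> range (placement \<sigma> r (Suc t))" for t
  proof -
    obtain w where w: "f (Suc t) = (fst (f t) @ [w], after (fst (f t)) (snd (f t)))"
      "last (fst (f t)) \<rightarrow>\<^bsub>G\<^esub> w" "w \<notin> occupied (after (fst (f t)) (snd (f t)))"
      using f(2)[of t] by (auto simp: Q_def)
    have "w = r (Suc t)" using w(1) by (simp add: r_def)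
    moreover have "after (fst (f t)) (snd (f t)) = placement \<sigma> r (Suc t)"
      using w(1) hist[of "Suc t"] by (metis snd_conv)
    ultimately show ?thesis using w(2,3) by (auto simp: r_def occupied_def)
  qed
  moreover have "r 0 \<in> verts G" using v by (simp add: r_def)
  ultimately have "robber_escapes G \<sigma> r" unfolding robber_escapes_def by blast
  with no show False by blast
qed

section \<open>Large strongly connected cores\<close>

text \<open>Otherwise \<open>q\<close> elements of \<open>A\<close> and \<open>q\<close> elements
  outside would be joined by a pair of \<open>R\<close> that leaves \<open>A\<close>.\<close>

lemma large_closed_set:
  fixes q :: nat
  assumes "finite W"
    and exp: "\<And>A B. A \<subseteq> W \<Longrightarrow> B \<subseteq> W \<Longrightarrow> A \<inter> B = {} \<Longrightarrow> card A = q \<Longrightarrow> card B = q \<Longrightarrow>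
      \<exists>a\<in>A. \<exists>b\<in>B. (a, b) \<in> R"
    and "A \<subseteq> W" "R `` A \<subseteq> A" "q \<le> card A"
  shows "card (W - A) < q"
proof (rule ccontr)
  assume "\<not> card (W - A) < q"
  then obtain B where B: "B \<subseteq> W - A" "card B = q"
    by (metis linorder_not_less obtain_subset_with_card_n)
  obtain A' where A': "A' \<subseteq> A" "card A' = q"
    by (metis assms(5) obtain_subset_with_card_n)
  obtain a b where "a \<in> A'" "b \<in> B" "(a, b) \<in> R" using exp[of A' B] A' B assms(3) by blast
  with A' B assms(4) show False by blast
qed

lemma Image_rtrancl_closed: "R `` (R\<^sup>* `` F) \<subseteq> R\<^sup>* `` F"
  by (blast intro: rtrancl_into_rtrancl)

lemma Image_rtrancl_subset:
  assumes "R \<subseteq> W \<times> W" "F \<subseteq> W"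
  shows "R\<^sup>* `` F \<subseteq> W"
proof -
  have "b \<in> W" if "(a, b) \<in> R\<^sup>*" "a \<in> W" for a b
    using that assms(1) by (induction rule: rtrancl_induct) auto
  with assms(2) show ?thesis by blast
qed

text \<open>
  A union of sets closed under \<open>R\<close> is closed, and no closed set has between \<open>q\<close> and \<open>2 * q\<close> elements,
  so uniting the small closed sets one after the other never leads out of the small ones.
\<close>

lemma few_small_reach:
  fixes q :: nat
  assumes fin: "finite W" and W: "3 * q \<le> card W" and "0 < q" and R: "R \<subseteq> W \<times> W"
    and exp: "\<And>A B. A \<subseteq> W \<Longrightarrow> B \<subseteq> W \<Longrightarrow> A \<inter> B = {} \<Longrightarrow> card A = q \<Longrightarrow> card B = q \<Longrightarrow>
      \<exists>a\<in>A. \<exists>b\<in>B. (a, b) \<in> R"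
  shows "card {v \<in> W. card (R\<^sup>* `` {v}) < q} < q"
proof -
  let ?U = "{v \<in> W. card (R\<^sup>* `` {v}) < q}"
  note in_W = Image_rtrancl_subset[OF R]
  have small: "card (R\<^sup>* `` F) < q" if "finite F" "F \<subseteq> ?U" for F
    using that
  proof (induction F rule: finite_induct)
    case (insert v F)
    have "insert v F \<subseteq> W" using insert.prems by auto
    note sub = in_W[OF this]
    have "R\<^sup>* `` insert v F = R\<^sup>* `` {v} \<union> R\<^sup>* `` F" by blast
    then have "card (R\<^sup>* `` insert v F) \<le> card (R\<^sup>* `` {v}) + card (R\<^sup>* `` F)"
      by (simp only: card_Un_le)
    also have "\<dots> < 2 * q" using insert by auto
    finally have lt: "card (R\<^sup>* `` insert v F) < 2 * q" .
    show ?case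
    proof (rule ccontr)
      assume "\<not> ?thesis"
      then have "card (W - R\<^sup>* `` insert v F) < q"
        by (intro large_closed_set[OF fin exp sub Image_rtrancl_closed]) auto
      moreover have "card (W - R\<^sup>* `` insert v F) = card W - card (R\<^sup>* `` insert v F)"
        by (intro card_Diff_subset finite_subset[OF sub fin] sub)
      ultimately show False using lt W by linarith
    qed
  qed (use \<open>0 < q\<close> in simp)
  have "card (R\<^sup>* `` ?U) < q"
    by (rule small) (use fin in simp_all)
  moreover have "card ?U \<le> card (R\<^sup>* `` ?U)"
  proof (rule card_mono)
    have "R\<^sup>* `` ?U \<subseteq> W" by (rule in_W) blast
    then show "finite (R\<^sup>* `` ?U)" using fin by (rule finite_subset)
  qed blast
  ultimately show ?thesis by linarith
qed

text \<open>At least \<open>7 * q + 1\<close> vertices survive the deletion. Discarding those with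
  small forward or backward reach costs fewer than \<open>2 * q\<close>, so more than half of
  \<open>V\<close> remains. The connecting walks may leave \<open>S\<close>, but stay in
  \<open>V - Z\<close>.\<close>

lemma large_strong_core:
  fixes q :: nat
  assumes fin: "finite V" and V: "card V = 8 * q + 1" and q: "0 < q" and Z: "card Z \<le> q" "finite Z"
    and exp: "\<And>A B. A \<subseteq> V \<Longrightarrow> B \<subseteq> V \<Longrightarrow> A \<inter> B = {} \<Longrightarrow> card A = q \<Longrightarrow> card B = q \<Longrightarrow>
      \<exists>a\<in>A. \<exists>b\<in>B. (a, b) \<in> E"
  obtains S where "S \<subseteq> V - Z" "card V < 2 * card S"
    "\<And>u w. u \<in> S \<Longrightarrow> w \<in> S \<Longrightarrow> (u, w) \<in> (E \<inter> (V - Z) \<times> (V - Z))\<^sup>*"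
proof -
  define W where "W = V - Z"
  define R where "R = E \<inter> W \<times> W"
  have finW: "finite W" using fin by (simp add: W_def)
  have W: "7 * q + 1 \<le> card W" using diff_card_le_card_Diff[OF Z(2), of V] Z V by (simp add: W_def)
  have expR: "\<exists>a\<in>A. \<exists>b\<in>B. (a, b) \<in> R"
    if "A \<subseteq> W" "B \<subseteq> W" "A \<inter> B = {}" "card A = q" "card B = q" for A B
    using exp[of A B] that unfolding W_def R_def by blast
  have expR': "\<exists>a\<in>A. \<exists>b\<in>B. (a, b) \<in> R\<inverse>"
    if "A \<subseteq> W" "B \<subseteq> W" "A \<inter> B = {}" "card A = q" "card B = q" for A B
    using expR[of B A] that by blast
  define U where "U = {v \<in> W. card (R\<^sup>* `` {v}) < q}"
  define U' where "U' = {v \<in> W. card ((R\<inverse>)\<^sup>* `` {v}) < q}"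
  have U: "card U < q" unfolding U_def
    by (rule few_small_reach[OF finW _ q _ expR]) (use W in \<open>auto simp: R_def\<close>)
  have U': "card U' < q" unfolding U'_def
    by (rule few_small_reach[OF finW _ q _ expR']) (use W in \<open>auto simp: R_def\<close>)
  define S where "S = W - (U \<union> U')"
  have "card W - card (U \<union> U') \<le> card S"
    unfolding S_def by (rule diff_card_le_card_Diff) (use finW in \<open>auto simp: U_def U'_def\<close>)
  then have "card V < 2 * card S" using card_Un_le[of U U'] U U' W V by linarith
  moreover have "(u, w) \<in> R\<^sup>*" if "u \<in> S" "w \<in> S" for u w
  proof -
    have RW: "R \<subseteq> W \<times> W" "R\<inverse> \<subseteq> W \<times> W" by (auto simp: R_def)
    note sub = Image_rtrancl_subset[OF RW(1), of "{u}"] Image_rtrancl_subset[OF RW(2), of "{w}"]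
    have F: "card (W - R\<^sup>* `` {u}) < q"
      by (rule large_closed_set[OF finW expR _ Image_rtrancl_closed]) (use that sub in \<open>auto simp: S_def U_def\<close>)
    have B: "card (W - (R\<inverse>)\<^sup>* `` {w}) < q"
      by (rule large_closed_set[OF finW expR' _ Image_rtrancl_closed])
        (use that sub in \<open>auto simp: S_def U'_def\<close>)
    \<comment> \<open>Both sets miss fewer than \<open>q\<close> elements of \<open>W\<close>, so
      they share a vertex, through which \<open>u\<close> reaches \<open>w\<close>.\<close>
    have "R\<^sup>* `` {u} \<inter> (R\<inverse>)\<^sup>* `` {w} \<noteq> {}"
    proof
      assume "R\<^sup>* `` {u} \<inter> (R\<inverse>)\<^sup>* `` {w} = {}"
      then have "W = (W - R\<^sup>* `` {u}) \<union> (W - (R\<inverse>)\<^sup>* `` {w})" by blast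
      then have "card W \<le> card (W - R\<^sup>* `` {u}) + card (W - (R\<inverse>)\<^sup>* `` {w})"
        by (metis card_Un_le)
      with F B W show False by linarith
    qed
    then obtain x where "(u, x) \<in> R\<^sup>*" "(w, x) \<in> (R\<inverse>)\<^sup>*" by blast
    then have "(u, x) \<in> R\<^sup>*" "(x, w) \<in> R\<^sup>*" by (auto simp: rtrancl_converse)
    then show ?thesis by simp
  qed
  ultimately show thesis using that[of S] by (auto simp: S_def W_def R_def)
qed

section \<open>Expansion by counting\<close>

text \<open>The first \<open>d\<close> full blocks of length \<open>m\<close> lie below
  \<open>N\<close>, and each contains every residue once.\<close>

lemma card_mod_in_ge:
  fixes m d N :: nat
  assumes "A \<subseteq> {..<m}" "d * m \<le> N"
  shows "d * card A \<le> card {e \<in> {..<N}. e mod m \<in> A}"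
proof -
  have "card ({..<d} \<times> A) \<le> card {e \<in> {..<N}. e mod m \<in> A}"
  proof (rule card_inj_on_le)
    have m: "(i * m + v) div m = i" "(i * m + v) mod m = v" if "v \<in> A" for i v
      using that assms(1) by auto
    show "inj_on (\<lambda>(i, v). i * m + v) ({..<d} \<times> A)"
      by (rule inj_onI) (use m in \<open>clarsimp, metis\<close>)
    show "(\<lambda>(i, v). i * m + v) ` ({..<d} \<times> A) \<subseteq> {e \<in> {..<N}. e mod m \<in> A}"
    proof
      fix e assume "e \<in> (\<lambda>(i, v). i * m + v) ` ({..<d} \<times> A)"
      then obtain i v where iv: "i < d" "v \<in> A" and e: "e = i * m + v" by auto
      then have "v < m" using assms(1) by auto
      have "i * m + v < Suc i * m" using \<open>v < m\<close> by simp
      also have "\<dots> \<le> d * m" using iv by (intro mult_right_mono) auto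
      also note assms(2)
      finally show "e \<in> {e \<in> {..<N}. e mod m \<in> A}" using m iv e by auto
    qed
  qed simp
  then show ?thesis by (simp add: card_cartesian_product)
qed

text \<open>Edge \<open>e\<close> has tail \<open>e mod m\<close> and \<open>8 * q\<close> possible
  heads. For fixed \<open>A\<close> and \<open>B\<close>, at least \<open>100 * q\<close> edges
  start in \<open>A\<close>, and missing \<open>B\<close> with all of them leaves a fraction of at
  most \<open>(7 / 8) ^ (100 * q)\<close> of the choices. The union bound over at most
  \<open>4 ^ m\<close> pairs succeeds because \<open>4 ^ 9 * (7 / 8) ^ 100 < 1\<close>.\<close>

lemma ex_expanding_heads:
  fixes q m N :: nat
  assumes q: "0 < q" and m: "m = 8 * q + 1" and N: "100 * m \<le> N"
  obtains h :: "nat \<Rightarrow> nat" where "\<And>e. e < N \<Longrightarrow> h e < m \<and> h e \<noteq> e mod m"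
    "\<And>A B. A \<subseteq> {..<m} \<Longrightarrow> B \<subseteq> {..<m} \<Longrightarrow> A \<inter> B = {} \<Longrightarrow> card A = q \<Longrightarrow> card B = q \<Longrightarrow>
      \<exists>e<N. e mod m \<in> A \<and> h e \<in> B"
proof -
  define V where "V = {..<m}"
  define \<Omega> where "\<Omega> = Pi\<^sub>E {..<N} (\<lambda>e. V - {e mod m})"
  define bad where
    "bad A B = Pi\<^sub>E {..<N} (\<lambda>e. if e mod m \<in> A then V - {e mod m} - B else V - {e mod m})" for A B
  define I where "I = {(A, B). A \<subseteq> V \<and> B \<subseteq> V \<and> A \<inter> B = {} \<and> card A = q \<and> card B = q}"
  have finV: "finite V" by (simp add: V_def)
  have cardV: "card (V - {e mod m}) = 8 * q" for e using m by (simp add: V_def)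
  have card_\<Omega>: "card \<Omega> = (8 * q) ^ N" by (simp add: \<Omega>_def card_PiE cardV)
  have IPow: "I \<subseteq> Pow V \<times> Pow V" by (auto simp: I_def)
  then have finI: "finite I" by (rule finite_subset) (simp add: finV)
  have "card I \<le> card (Pow V \<times> Pow V)" by (rule card_mono[OF _ IPow]) (simp add: finV)
  also have "\<dots> = 4 ^ m"
    by (simp add: card_cartesian_product card_Pow finV V_def power_mult_distrib[symmetric])
  finally have card_I: "card I \<le> 4 ^ m" .
  have card_bad: "real (card (bad A B)) \<le> (7 / 8) ^ (100 * q) * real (8 * q) ^ N"
    if "(A, B) \<in> I" for A B
  proof -
    have AB: "A \<subseteq> V" "B \<subseteq> V" "A \<inter> B = {}" "card A = q" "card B = q" using that by (auto simp: I_def)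
    let ?K = "{e \<in> {..<N}. e mod m \<in> A}"
    \<comment> \<open>The tail lies in \<open>A\<close>, hence not in \<open>B\<close>, so removing
      \<open>B\<close> costs exactly \<open>q\<close> further heads.\<close>
    have "card (V - {e mod m} - B) = 7 * q" if "e mod m \<in> A" for e
    proof -
      have "card (V - {e mod m} - B) = card (V - {e mod m}) - card B"
        by (rule card_Diff_subset) (use AB that finV finite_subset in auto)
      then show ?thesis using cardV AB by simp
    qed
    then have "card (bad A B) = (\<Prod>e<N. if e mod m \<in> A then 7 * q else 8 * q)"
      by (auto simp: bad_def card_PiE cardV intro!: prod.cong)
    then have "real (card (bad A B)) = (\<Prod>e<N. (if e mod m \<in> A then 7 / 8 else 1) * real (8 * q))"
      by (auto intro!: prod.cong)
    also have "\<dots> = (\<Prod>e<N. if e mod m \<in> A then 7 / 8 else 1) * real (8 * q) ^ N"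
      by (simp add: prod.distrib)
    also have "(\<Prod>e<N. if e mod m \<in> A then 7 / 8 else 1 :: real) = (7 / 8) ^ card ?K"
      by (subst prod.inter_filter[symmetric]) auto
    also have "\<dots> \<le> (7 / 8) ^ (100 * q)"
    proof (rule power_decreasing)
      show "100 * q \<le> card ?K" using card_mod_in_ge[of A m 100 N] AB N by (simp add: V_def)
    qed auto
    finally show ?thesis by (simp add: mult_right_mono)
  qed
  have "real (card (\<Union>(A, B)\<in>I. bad A B)) \<le> (\<Sum>(A, B)\<in>I. real (card (bad A B)))"
    using card_UN_le[OF finI, of "\<lambda>(A, B). bad A B"]
    by (simp add: case_prod_unfold flip: of_nat_sum)
  also have "\<dots> \<le> (\<Sum>(A, B)\<in>I. (7 / 8) ^ (100 * q) * real (8 * q) ^ N)"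
    using card_bad by (intro sum_mono) auto
  also have "\<dots> = real (card I) * ((7 / 8) ^ (100 * q) * real (8 * q) ^ N)"
    by simp
  also have "\<dots> \<le> 4 ^ m * ((7 / 8) ^ (100 * q) * real (8 * q) ^ N)"
    using card_I by (intro mult_right_mono) (simp_all flip: of_nat_power)
  also have "\<dots> \<le> 4 ^ (9 * q) * ((7 / 8) ^ (100 * q) * real (8 * q) ^ N)"
    using m q by (intro mult_right_mono power_increasing) auto
  also have "\<dots> = (4 ^ 9 * (7 / 8) ^ 100) ^ q * real (8 * q) ^ N"
    by (simp only: power_mult power_mult_distrib mult.assoc)
  also have "\<dots> < 1 * real (8 * q) ^ N"
  proof (rule mult_strict_right_mono)
    have "(4 ^ 9 * (7 / 8) ^ 100 :: real) < 1" by (simp add: power_divide)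
    then show "(4 ^ 9 * (7 / 8) ^ 100 :: real) ^ q < 1"
      by (subst power_less_one_iff) (use q in simp_all)
  qed (use q in simp)
  also have "\<dots> = real (card \<Omega>)" by (simp add: card_\<Omega>)
  finally have "card (\<Union>(A, B)\<in>I. bad A B) < card \<Omega>" by simp
  moreover have "finite (\<Union>(A, B)\<in>I. bad A B)"
    using finI finV by (auto simp: bad_def intro!: finite_PiE)
  ultimately obtain h where h: "h \<in> \<Omega>" "h \<notin> (\<Union>(A, B)\<in>I. bad A B)"
    by (metis card_mono leD subsetI)
  show thesis
  proof (rule that)
    show "h e < m \<and> h e \<noteq> e mod m" if "e < N" for e
      using h(1) that by (auto simp: \<Omega>_def V_def PiE_iff)
    show "\<exists>e<N. e mod m \<in> A \<and> h e \<in> B"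
      if "A \<subseteq> {..<m}" "B \<subseteq> {..<m}" "A \<inter> B = {}" "card A = q" "card B = q" for A B
    proof (rule ccontr)
      assume *: "\<not> ?thesis"
      have "h \<in> bad A B" using h(1) * by (auto simp: bad_def \<Omega>_def PiE_iff)
      with that h(2) show False by (auto simp: I_def V_def)
    qed
  qed
qed

section \<open>Permutations with prescribed orbits\<close>

text \<open>Number \<open>C\<close> and shift cyclically by one; with at least two elements nothing
  stays fixed.\<close>

lemma ex_cyclic_perm:
  assumes "finite C" "2 \<le> card C"
  obtains p where "bij_betw p C C" "\<And>x. x \<in> C \<Longrightarrow> p x \<noteq> x"
    "\<And>x y. x \<in> C \<Longrightarrow> y \<in> C \<Longrightarrow> (x, y) \<in> {(z, p z) |z. z \<in> C}\<^sup>*"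
proof -
  define s where "s = card C"
  have s: "2 \<le> s" using assms by (simp add: s_def)
  obtain g where g: "bij_betw g {0..<s} C"
    using ex_bij_betw_nat_finite[OF assms(1)] by (auto simp: s_def)
  define p where "p x = g (Suc (the_inv_into {0..<s} g x) mod s)" for x
  have inj: "inj_on g {0..<s}" and img: "g ` {0..<s} = C" using g by (auto simp: bij_betw_def)
  have p: "p (g i) = g (Suc i mod s)" if "i < s" for i
    using that inj by (simp add: p_def the_inv_into_f_f)
  have gC: "g (i mod s) \<in> C" for i using img s by auto
  have "p ` C = C"
  proof
    show "p ` C \<subseteq> C" using gC by (auto simp: p_def)
    show "C \<subseteq> p ` C"
    proof
      fix y assume "y \<in> C"
      then obtain i where i: "i < s" "y = g i" using img by auto
      \<comment> \<open>Adding \<open>s - 1\<close> modulo \<open>s\<close> gives the cyclic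
        predecessor, also for \<open>i = 0\<close>.\<close>
      have "y = p (g ((i + (s - 1)) mod s))"
        using i s by (subst p) (auto simp: mod_Suc_eq)
      with gC show "y \<in> p ` C" by blast
    qed
  qed
  then have 1: "bij_betw p C C" using assms(1) by (simp add: bij_betw_def eq_card_imp_inj_on)
  have 2: "p x \<noteq> x" if x: "x \<in> C" for x
  proof
    assume eq: "p x = x"
    obtain i where i: "i < s" "x = g i" using x img by auto
    then have "g (Suc i mod s) = g i" using p eq by simp
    then have "Suc i mod s = i" using inj i s by (auto simp: inj_on_def)
    then show False using i s by (cases "Suc i = s") auto
  qed
  have walk: "(g i, g ((i + j) mod s)) \<in> {(z, p z) |z. z \<in> C}\<^sup>*" if "i < s" for i j
  proof (induction j)
    case (Suc j)
    have "(g ((i + j) mod s), g ((i + Suc j) mod s)) \<in> {(z, p z) |z. z \<in> C}"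
      using p[of "(i + j) mod s"] gC[of "i + j"] s by (auto simp: mod_Suc_eq)
    with Suc show ?case by (rule rtrancl_into_rtrancl)
  qed (use that in simp)
  have 3: "(x, y) \<in> {(z, p z) |z. z \<in> C}\<^sup>*" if xy: "x \<in> C" "y \<in> C" for x y
  proof -
    obtain i j where ij: "i < s" "x = g i" "j < s" "y = g j" using xy img by fastforce
    \<comment> \<open>Walking on to the end of the cycle and then \<open>j\<close> steps further
      also covers \<open>j < i\<close>.\<close>
    then have "(i + (s - i + j)) mod s = j" by simp
    with walk[OF ij(1), of "s - i + j"] ij show ?thesis by simp
  qed
  show thesis using that 1 2 3 by blast
qed

text \<open>Glue together one cyclic permutation per fibre of \<open>cls\<close>. With labels as
  classes, the orbits are the cycles that replace the labels.\<close>

lemma ex_perm_with_orbits: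
  fixes cls :: "'a \<Rightarrow> 'c"
  assumes "finite S" and two: "\<And>x. x \<in> S \<Longrightarrow> 2 \<le> card {y \<in> S. cls y = cls x}"
  obtains p where "bij_betw p S S" "\<And>x. x \<in> S \<Longrightarrow> p x \<noteq> x" "\<And>x. x \<in> S \<Longrightarrow> cls (p x) = cls x"
    "\<And>x y. x \<in> S \<Longrightarrow> y \<in> S \<Longrightarrow> cls x = cls y \<Longrightarrow> (x, y) \<in> {(z, p z) |z. z \<in> S \<and> cls z = cls x}\<^sup>*"
proof -
  define C where "C c = {y \<in> S. cls y = c}" for c
  define orbit_perm where "orbit_perm c p \<longleftrightarrow> bij_betw p (C c) (C c) \<and> (\<forall>x\<in>C c. p x \<noteq> x) \<and>
    (\<forall>x\<in>C c. \<forall>y\<in>C c. (x, y) \<in> {(z, p z) |z. z \<in> C c}\<^sup>*)" for c p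
  have "\<forall>c\<in>cls ` S. \<exists>p. orbit_perm c p"
  proof
    fix c assume "c \<in> cls ` S"
    then have C: "finite (C c)" "2 \<le> card (C c)" using assms by (auto simp: C_def)
    show "\<exists>p. orbit_perm c p"
      by (rule ex_cyclic_perm[OF C], unfold orbit_perm_def) blast
  qed
  from bchoice[OF this] obtain P where "\<forall>c\<in>cls ` S. orbit_perm c (P c)" by blast
  then have P: "\<And>c. c \<in> cls ` S \<Longrightarrow> bij_betw (P c) (C c) (C c)"
    "\<And>c x. c \<in> cls ` S \<Longrightarrow> x \<in> C c \<Longrightarrow> P c x \<noteq> x"
    "\<And>c x y. c \<in> cls ` S \<Longrightarrow> x \<in> C c \<Longrightarrow> y \<in> C c \<Longrightarrow> (x, y) \<in> {(z, P c z) |z. z \<in> C c}\<^sup>*"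
    unfolding orbit_perm_def by blast+
  define p where "p x = P (cls x) x" for x
  have mem: "p x \<in> C (cls x)" if "x \<in> S" for x
    using P(1)[of "cls x"] that by (auto simp: p_def C_def bij_betw_def)
  have "p ` S = S"
  proof
    show "p ` S \<subseteq> S" using mem by (auto simp: C_def)
    show "S \<subseteq> p ` S"
    proof
      fix y assume y: "y \<in> S"
      then have "y \<in> P (cls y) ` C (cls y)" using P(1)[of "cls y"] by (auto simp: C_def bij_betw_def)
      then obtain x where x: "x \<in> C (cls y)" "P (cls y) x = y" by auto
      then have "x \<in> S" "p x = y" by (simp_all add: C_def p_def)
      then show "y \<in> p ` S" by blast
    qed
  qed
  then have 1: "bij_betw p S S" using assms(1) by (simp add: bij_betw_def eq_card_imp_inj_on)
  have 2: "p x \<noteq> x" "cls (p x) = cls x" if "x \<in> S" for x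
    using P(2)[of "cls x" x] mem[OF that] that by (auto simp: p_def C_def)
  have 3: "(x, y) \<in> {(z, p z) |z. z \<in> S \<and> cls z = cls x}\<^sup>*" if "x \<in> S" "y \<in> S" "cls x = cls y" for x y
  proof -
    have "{(z, P (cls x) z) |z. z \<in> C (cls x)} = {(z, p z) |z. z \<in> S \<and> cls z = cls x}"
      by (auto simp: p_def C_def)
    then show ?thesis using P(3)[of "cls x" x y] that by (simp add: C_def)
  qed
  show thesis using that[OF 1 2 3] by blast
qed

section \<open>The cubic digraph\<close>

text \<open>The vertices \<open>2 * e\<close> and \<open>2 * e + 1\<close> are the tail end and the head end of edge \<open>e\<close>.\<close>

definition perm_matching_digraph :: "nat \<Rightarrow> (nat \<Rightarrow> nat) \<Rightarrow> (nat, nat \<times> nat) pre_digraph" where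
  "perm_matching_digraph N p =
    \<lparr>verts = {..<2 * N}, arcs = {(x, p x) |x. x < 2 * N} \<union> {(2 * e, 2 * e + 1) |e. e < N},
     tail = fst, head = snd\<rparr>"

lemma dominates_perm_matching_digraph:
  "x \<rightarrow>\<^bsub>perm_matching_digraph N p\<^esub> y \<longleftrightarrow>
    x < 2 * N \<and> y = p x \<or> (\<exists>e<N. x = 2 * e \<and> y = 2 * e + 1)"
  by (force simp: perm_matching_digraph_def arcs_ends_def arc_to_ends_def image_iff)

text \<open>Each vertex has one arc of \<open>p\<close> in, one out, and one matching arc. Arcs are
  pairs, so \<open>nm\<close> is what keeps a matching arc from merging with an arc of
  \<open>p\<close>; the absence of fixed points rules out loops.\<close>

lemma perm_matching_digraph_cubic:
  assumes p: "bij_betw p {..<2 * N} {..<2 * N}" "\<And>x. x < 2 * N \<Longrightarrow> p x \<noteq> x"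
    and nm: "\<And>e. e < N \<Longrightarrow> p (2 * e) \<noteq> 2 * e + 1"
  defines "G \<equiv> perm_matching_digraph N p"
  shows "digraph G" "\<And>v. v \<in> verts G \<Longrightarrow> in_degree G v + out_degree G v = 3"
proof -
  have pm: "p x < 2 * N" if "x < 2 * N" for x using p(1) that by (auto simp: bij_betw_def)
  show "digraph G"
    by unfold_locales
      (use pm p(2)[symmetric] in \<open>auto simp: G_def perm_matching_digraph_def arc_to_ends_def
        intro: finite_subset[of _ "{..<2 * N} \<times> {..<2 * N}"]\<close>)
  fix v assume "v \<in> verts G"
  then have v: "v < 2 * N" by (simp add: G_def perm_matching_digraph_def)
  obtain u where u: "u < 2 * N" "p u = v" using p(1) v by (metis bij_betw_def imageE lessThan_iff)
  have pre: "{x. x < 2 * N \<and> p x = v} = {u}"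
  proof
    show "{x. x < 2 * N \<and> p x = v} \<subseteq> {u}"
      using p(1) u unfolding bij_betw_def inj_on_def by blast
  qed (use u in blast)
  have in_arcs: "in_arcs G v =
      (\<lambda>x. (x, v)) ` ({x. x < 2 * N \<and> p x = v} \<union> {2 * e |e. e < N \<and> v = 2 * e + 1})"
    by (auto simp: in_arcs_def G_def perm_matching_digraph_def)
  show "in_degree G v + out_degree G v = 3"
  proof (cases "even v")
    case True
    then obtain e where e: "v = 2 * e" by (elim evenE)
    have "in_arcs G v = {(u, v)}"
      unfolding in_arcs pre using True by auto
    moreover have "out_arcs G v = {(v, p v), (v, v + 1)}"
      using v e by (auto simp: out_arcs_def G_def perm_matching_digraph_def)
    moreover have "p v \<noteq> v + 1" using nm[of e] e v by auto
    ultimately show ?thesis by (simp add: in_degree_def out_degree_def)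
  next
    case False
    then obtain e where e: "v = 2 * e + 1" by (elim oddE)
    have "in_arcs G v = {(u, v), (2 * e, v)}"
      unfolding in_arcs pre using e v by auto
    moreover have "out_arcs G v = {(v, p v)}"
      using v False by (auto simp: out_arcs_def G_def perm_matching_digraph_def)
    moreover have "u \<noteq> 2 * e" using nm[of e] u e v by auto
    ultimately show ?thesis by (simp add: in_degree_def out_degree_def)
  qed
qed

lemma ex_cubic_digraph_not_catch:
  fixes q N :: nat
  assumes q: "0 < q" and N: "100 * (8 * q + 1) \<le> N"
  obtains G :: "(nat, nat \<times> nat) pre_digraph" where "digraph G" "card (verts G) = 2 * N"
    "\<And>v. v \<in> verts G \<Longrightarrow> in_degree G v + out_degree G v = 3"
    "\<And>k. k \<le> q \<Longrightarrow> \<not> cops_can_catch G k"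
proof -
  define m where "m = 8 * q + 1"
  obtain h where h: "\<And>e. e < N \<Longrightarrow> h e < m \<and> h e \<noteq> e mod m"
    and exp: "\<And>A B. A \<subseteq> {..<m} \<Longrightarrow> B \<subseteq> {..<m} \<Longrightarrow> A \<inter> B = {} \<Longrightarrow> card A = q \<Longrightarrow> card B = q \<Longrightarrow>
      \<exists>e<N. e mod m \<in> A \<and> h e \<in> B"
    by (rule ex_expanding_heads[OF q m_def N[folded m_def]]) blast
  define cls where "cls x = (if even x then (x div 2) mod m else h (x div 2))" for x
  have cls: "cls x < m" if "x < 2 * N" for x
    using that h[of "x div 2"] by (auto simp: cls_def m_def)
  \<comment> \<open>The edges \<open>u\<close> and \<open>u + m\<close> both have tail
    \<open>u\<close>. Their tail ends make each cycle long enough, and later provide two common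
    vertices of two havens.\<close>
  have pair: "{2 * u, 2 * (u + m)} \<subseteq> {x \<in> {..<2 * N}. cls x = u}" if "u < m" for u
  proof -
    have "u + m < N" using that N by (simp add: m_def)
    moreover have "(u + m) mod m = u" using that by simp
    ultimately show ?thesis by (simp add: cls_def)
  qed
  have two: "2 \<le> card {x \<in> {..<2 * N}. cls x = u}" if "u < m" for u
    using card_mono[OF _ pair[OF that]] that by (simp add: m_def)
  have "2 \<le> card {y \<in> {..<2 * N}. cls y = cls x}" if "x \<in> {..<2 * N}" for x
    using two cls that by simp
  then obtain p where p: "bij_betw p {..<2 * N} {..<2 * N}"
    "\<And>x. x \<in> {..<2 * N} \<Longrightarrow> p x \<noteq> x" "\<And>x. x \<in> {..<2 * N} \<Longrightarrow> cls (p x) = cls x"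
    "\<And>x y. x \<in> {..<2 * N} \<Longrightarrow> y \<in> {..<2 * N} \<Longrightarrow> cls x = cls y \<Longrightarrow>
      (x, y) \<in> {(z, p z) |z. z \<in> {..<2 * N} \<and> cls z = cls x}\<^sup>*"
    by (rule ex_perm_with_orbits[OF finite_lessThan]) blast+
  note p = p[unfolded lessThan_iff]
  define G where "G = perm_matching_digraph N p"
  \<comment> \<open>\<open>p\<close> preserves labels, whereas the two ends of an edge have
    different ones.\<close>
  have nm: "p (2 * e) \<noteq> 2 * e + 1" if "e < N" for e
  proof
    assume "p (2 * e) = 2 * e + 1"
    then have "cls (2 * e + 1) = cls (2 * e)" using p(3)[of "2 * e"] that by simp
    then show False using h[OF that] by (simp add: cls_def)
  qed
  note cubic = perm_matching_digraph_cubic[OF p(1,2) nm, folded G_def]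
  have vG: "verts G = {..<2 * N}" by (simp add: G_def perm_matching_digraph_def)
  define E where "E = {(e mod m, h e) |e. e < N}"
  define core where "core Z S \<longleftrightarrow> S \<subseteq> {..<m} - Z \<and> m < 2 * card S \<and>
    (\<forall>u\<in>S. \<forall>w\<in>S. (u, w) \<in> (E \<inter> ({..<m} - Z) \<times> ({..<m} - Z))\<^sup>*)" for Z S
  define \<gamma> where "\<gamma> X = (SOME S. core (cls ` X) S)" for X
  define \<beta> where "\<beta> X = {x \<in> {..<2 * N}. cls x \<in> \<gamma> X}" for X
  have \<gamma>: "core (cls ` X) (\<gamma> X)" if "finite X" "card X \<le> q" for X
  proof -
    have exp': "\<exists>a\<in>A. \<exists>b\<in>B. (a, b) \<in> E"
      if "A \<subseteq> {..<m}" "B \<subseteq> {..<m}" "A \<inter> B = {}" "card A = q" "card B = q" for A B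
      using exp[OF that] by (auto simp: E_def)
    have cZ: "card (cls ` X) \<le> q" using card_image_le[OF that(1), of cls] that(2) by linarith
    have fZ: "finite (cls ` X)" using that(1) by simp
    have cV: "card {..<m} = 8 * q + 1" by (simp add: m_def)
    obtain S where "S \<subseteq> {..<m} - cls ` X" "card {..<m} < 2 * card S"
      "\<And>u w. u \<in> S \<Longrightarrow> w \<in> S \<Longrightarrow> (u, w) \<in> (E \<inter> ({..<m} - cls ` X) \<times> ({..<m} - cls ` X))\<^sup>*"
      by (rule large_strong_core[OF finite_lessThan cV q cZ fZ exp']) blast+
    then have "core (cls ` X) S" by (auto simp: core_def)
    then show ?thesis unfolding \<gamma>_def by (rule someI)
  qed
  have within: "(x, y) \<in> (arcs_avoiding G X)\<^sup>*"
    if "x < 2 * N" "y < 2 * N" "cls x = cls y" "cls x \<notin> cls ` X" for x y X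
  proof -
    have "(z, p z) \<in> arcs_avoiding G X" if z: "z < 2 * N" "cls z = cls x" for z
    proof -
      have "p z \<notin> X" using p(3)[OF z(1)] z \<open>cls x \<notin> cls ` X\<close> by (metis imageI)
      with z show ?thesis by (simp add: arcs_avoiding_def G_def dominates_perm_matching_digraph)
    qed
    then have "{(z, p z) |z. z < 2 * N \<and> cls z = cls x} \<subseteq> arcs_avoiding G X" by auto
    with p(4)[OF that(1-3)] show ?thesis by (meson rtrancl_mono subsetD)
  qed
  \<comment> \<open>A label walk is lifted edge by edge: turn along the label's cycle to the tail
    end \<open>2 * e\<close>, cross to \<open>2 * e + 1\<close>, and turn along the next cycle. The
    endpoint \<open>y\<close> is generalized so that the induction hypothesis applies to
    \<open>2 * e\<close>.\<close>
  have lift: "(x, y) \<in> (arcs_avoiding G X)\<^sup>*"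
    if "(u, w) \<in> (E \<inter> ({..<m} - cls ` X) \<times> ({..<m} - cls ` X))\<^sup>*" "x < 2 * N" "cls x = u"
      "u \<notin> cls ` X" "y < 2 * N" "cls y = w" for u w x y X
    using that
  proof (induction arbitrary: y rule: rtrancl_induct)
    case base
    then show ?case by (intro within) auto
  next
    case (step v w)
    then obtain e where e: "e < N" "v = e mod m" "w = h e" by (auto simp: E_def)
    have ce: "cls (2 * e) = v" "cls (2 * e + 1) = w" using e by (simp_all add: cls_def)
    have "(x, 2 * e) \<in> (arcs_avoiding G X)\<^sup>*" using step ce e by simp
    moreover have "2 * e + 1 \<notin> X" using step.hyps(2) ce by (metis DiffD2 IntD2 SigmaD2 imageI)
    then have "(2 * e, 2 * e + 1) \<in> arcs_avoiding G X"
      using e by (auto simp: arcs_avoiding_def G_def dominates_perm_matching_digraph)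
    moreover have "(2 * e + 1, y) \<in> (arcs_avoiding G X)\<^sup>*"
      by (rule within) (use step ce e in auto)
    ultimately show ?case by (meson rtrancl.rtrancl_into_rtrancl rtrancl_trans)
  qed
  have "\<not> cops_can_catch G k" if k: "k \<le> q" for k
  proof (rule haven_imp_not_catch[where \<beta> = \<beta>])
    show "(x, y) \<in> (arcs_avoiding G X)\<^sup>*"
      if "finite X" "card X \<le> k" "x \<in> \<beta> X" "y \<in> \<beta> X" for X x y
      using \<gamma>[of X] that k by (intro lift[of "cls x" "cls y"]) (auto simp: \<beta>_def core_def)
    show "\<exists>z\<in>\<beta> X \<inter> \<beta> Y. z \<noteq> w"
      if "finite X" "card X \<le> k" "finite Y" "card Y \<le> k" for X Y w
    proof -
      have c: "core (cls ` X) (\<gamma> X)" "core (cls ` Y) (\<gamma> Y)" using \<gamma> that k by auto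
      \<comment> \<open>Two sets that each contain more than half of the \<open>m\<close> labels
        must meet.\<close>
      have "\<gamma> X \<inter> \<gamma> Y \<noteq> {}"
      proof
        assume dis: "\<gamma> X \<inter> \<gamma> Y = {}"
        have sub: "\<gamma> X \<subseteq> {..<m}" "\<gamma> Y \<subseteq> {..<m}" using c by (auto simp: core_def)
        then have "card (\<gamma> X) + card (\<gamma> Y) = card (\<gamma> X \<union> \<gamma> Y)"
          by (metis card_Un_disjoint dis finite_lessThan finite_subset)
        also have "\<dots> \<le> m" using card_mono[of "{..<m}" "\<gamma> X \<union> \<gamma> Y"] sub by simp
        finally show False using c by (auto simp: core_def)
      qed
      then obtain u where u: "u \<in> \<gamma> X" "u \<in> \<gamma> Y" by auto
      then have "u < m" using c by (auto simp: core_def)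
      from pair[OF this] u have "2 * u \<in> \<beta> X \<inter> \<beta> Y" "2 * (u + m) \<in> \<beta> X \<inter> \<beta> Y"
        by (auto simp: \<beta>_def)
      moreover have "2 * u \<noteq> 2 * (u + m)" by (simp add: m_def)
      ultimately show ?thesis by metis
    qed
    show "\<beta> {} \<subseteq> verts G" by (auto simp: \<beta>_def vG)
  qed
  with that[OF cubic(1) _ cubic(2)] show thesis by (simp add: vG)
qed

theorem corollary3:
  shows "\<exists>\<alpha>::real. \<alpha> > 0 \<and> (\<exists>n0::nat. \<forall>n::nat. n \<ge> n0 \<and> even n \<longrightarrow>
    (\<exists>G :: (nat, nat \<times> nat) pre_digraph.
       digraph G \<and> card (verts G) = 6 * n \<and>
       (\<forall>v \<in> verts G. in_degree G v + out_degree G v = 3) \<and>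
       real (entanglement G) > \<alpha> * real n))"
proof (intro exI[of _ "1 / 300"] conjI exI[of _ 300] allI impI)
  fix n :: nat
  assume n: "300 \<le> n \<and> even n"
  \<comment> \<open>Since \<open>1 \<le> q\<close>,
    \<open>100 * (8 * q + 1) \<le> 900 * q \<le> 3 * n\<close>. Rounding down is harmless:
    \<open>n < 300 * (q + 1)\<close>, and the entanglement is at least \<open>q + 1\<close>.\<close>
  define q where "q = n div 300"
  have "0 < q" "100 * (8 * q + 1) \<le> 3 * n" using n by (auto simp: q_def)
  then obtain G :: "(nat, nat \<times> nat) pre_digraph" where G: "digraph G" "card (verts G) = 2 * (3 * n)"
    "\<And>v. v \<in> verts G \<Longrightarrow> in_degree G v + out_degree G v = 3"
    "\<And>k. k \<le> q \<Longrightarrow> \<not> cops_can_catch G k"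
    using ex_cubic_digraph_not_catch by metis
  interpret digraph G by (rule G(1))
  have "cops_can_catch G (entanglement G)"
    unfolding entanglement_def using cops_can_catch_card_verts by (rule LeastI)
  then have "q < entanglement G" using G(4) by (metis not_le)
  then have "n < 300 * entanglement G" unfolding q_def by linarith
  then have "real n < 300 * real (entanglement G)" by linarith
  then show "\<exists>G :: (nat, nat \<times> nat) pre_digraph. digraph G \<and> card (verts G) = 6 * n \<and>
       (\<forall>v \<in> verts G. in_degree G v + out_degree G v = 3) \<and>
       real (entanglement G) > 1 / 300 * real n"
    using G by (intro exI[of _ G]) auto
qed simp

end
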